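(* Let $(\mathbf{A},\tau)$ be an SMV-algebra. Then $(\mathbf{A},\tau)$ is subdirectly irreducible if and only if the following three conditions all hold: (1) if $F_\tau(A)=\{1\}$, then the MV-algebra $\tau(\mathbf{A})$ is subdirectly irreducible; (2) the hoop $\mathbf{F}_\tau(\mathbf{A})$ is either trivial or a subdirectly irreducible hoop; (3) $\mathbf{F}_\tau(\mathbf{A})$ and $\tau(\mathbf{A})$ have the disjunction property, i.e. for all $x\in F_\tau(A)$ and $y\in\tau(A)$, if $x\vee y=1$ then $x=1$ or $y=1$.
   Context: An MV-algebra is $\mathbf{A}=(A,\oplus,\neg,0)$ with $(A,\oplus,0)$ a commutative monoid, $\neg\neg x=x$, $x\oplus 1=1$ where $1=\neg 0$, and $(x\to y)\to y=(y\to x)\to x$ where $x\to y=\neg x\oplus y$. Put $x\odot y=\neg(\neg x\oplus\neg y)$, $x\ominus y=\neg(\neg x\oplus y)$, $x\vee y=(x\to y)\to y$, $x\wedge y=x\odot(x\to y)$. An SMV-algebra is a pair $(\mathbf{A},\tau)$ with $\mathbf{A}$ an MV-algebra and $\tau:A\to A$ satisfying, for all $x,y$: $\tau(1)=1$; $\tau(x\oplus y)=\tau(x)\oplus\tau(y\ominus(x\odot y))$; $\tau(\neg x)=\neg\tau(x)$; $\tau(\tau(x)\oplus\tau(y))=\tau(x)\oplus\tau(y)$. It is regarded as an algebra in the signature $(\oplus,\neg,0,\tau)$. $\tau(\mathbf{A})$ is the MV-subalgebra of $\mathbf{A}$ with universe $\tau(A)=\{\tau(a):a\in A\}$. $F_\tau(A)=\{a\in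 A:\tau(a)=1\}$, and $\mathbf{F}_\tau(\mathbf{A})$ is the Wajsberg hoop $(F_\tau(A),\odot,\to,1)$. A Wajsberg hoop is a subalgebra of the $\{1,\odot,\to\}$-reduct of an MV-algebra. Convention: an algebra is subdirectly irreducible if it is nontrivial and has a least congruence among those different from the identity congruence. *)

theory Defs
  imports "HOL-Algebra.Group"
begin

text \<open>
  Congruences of an algebra with universe \<open>A\<close>, a set \<open>Us\<close> of unary and a set \<open>Bs\<close> of binary
  basic operations.  Constants of the signature impose no condition, by reflexivity.
\<close>

definition congruences ::
    "'a set \<Rightarrow> ('a \<Rightarrow> 'a) set \<Rightarrow> ('a \<Rightarrow> 'a \<Rightarrow> 'a) set \<Rightarrow> 'a rel set" where
  "congruences A Us Bs =
    {\<theta>. equiv A \<theta> \<and>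
        (\<forall>f\<in>Us. \<forall>(x, x')\<in>\<theta>. (f x, f x') \<in> \<theta>) \<and>
        (\<forall>g\<in>Bs. \<forall>(x, x')\<in>\<theta>. \<forall>(y, y')\<in>\<theta>. (g x y, g x' y') \<in> \<theta>)}"

definition subdirectly_irreducible :: "'a set \<Rightarrow> 'a rel set \<Rightarrow> bool" where
  "subdirectly_irreducible A Con \<longleftrightarrow>
    \<not> is_singleton A \<and>
    (\<exists>\<mu>\<in>Con. \<mu> \<noteq> Id_on A \<and> (\<forall>\<theta>\<in>Con. \<theta> \<noteq> Id_on A \<longrightarrow> \<mu> \<subseteq> \<theta>))"

record 'a mv_alg = "'a partial_object" +
  mv_plus :: "'a \<Rightarrow> 'a \<Rightarrow> 'a"  (infixl \<open>\<oplus>\<index>\<close> 65)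
  mv_neg :: "'a \<Rightarrow> 'a"
  mv_zero :: 'a

definition mv_one :: "('a, 'b) mv_alg_scheme \<Rightarrow> 'a" where
  "mv_one M = mv_neg M (mv_zero M)"

definition mv_imp :: "('a, 'b) mv_alg_scheme \<Rightarrow> 'a \<Rightarrow> 'a \<Rightarrow> 'a"  (infixr \<open>\<leadsto>\<index>\<close> 60) where
  "x \<leadsto>\<^bsub>M\<^esub> y = mv_neg M x \<oplus>\<^bsub>M\<^esub> y"

definition mv_times :: "('a, 'b) mv_alg_scheme \<Rightarrow> 'a \<Rightarrow> 'a \<Rightarrow> 'a"  (infixl \<open>\<odot>\<index>\<close> 70) where
  "x \<odot>\<^bsub>M\<^esub> y = mv_neg M (mv_neg M x \<oplus>\<^bsub>M\<^esub> mv_neg M y)"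

definition mv_minus :: "('a, 'b) mv_alg_scheme \<Rightarrow> 'a \<Rightarrow> 'a \<Rightarrow> 'a"  (infixl \<open>\<ominus>\<index>\<close> 65) where
  "x \<ominus>\<^bsub>M\<^esub> y = mv_neg M (mv_neg M x \<oplus>\<^bsub>M\<^esub> y)"

definition mv_join :: "('a, 'b) mv_alg_scheme \<Rightarrow> 'a \<Rightarrow> 'a \<Rightarrow> 'a" where
  "mv_join M x y = (x \<leadsto>\<^bsub>M\<^esub> y) \<leadsto>\<^bsub>M\<^esub> y"

locale mv_algebra =
  fixes M :: "('a, 'b) mv_alg_scheme" (structure)
  assumes plus_comm_monoid:
      "comm_monoid \<lparr>carrier = carrier M, mult = mv_plus M, one = mv_zero M\<rparr>"
    and neg_closed: "x \<in> carrier M \<Longrightarrow> mv_neg M x \<in> carrier M"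
    and neg_neg: "x \<in> carrier M \<Longrightarrow> mv_neg M (mv_neg M x) = x"
    and plus_one: "x \<in> carrier M \<Longrightarrow> x \<oplus> mv_one M = mv_one M"
    and imp_imp_commute:
      "\<lbrakk>x \<in> carrier M; y \<in> carrier M\<rbrakk> \<Longrightarrow> (x \<leadsto> y) \<leadsto> y = (y \<leadsto> x) \<leadsto> x"

definition mv_congruences :: "('a, 'b) mv_alg_scheme \<Rightarrow> 'a rel set" where
  "mv_congruences M = congruences (carrier M) {mv_neg M} {mv_plus M}"

abbreviation subdirectly_irreducible_mv :: "('a, 'b) mv_alg_scheme \<Rightarrow> bool" where
  "subdirectly_irreducible_mv M \<equiv> subdirectly_irreducible (carrier M) (mv_congruences M)"

record 'a hoop = "'a monoid" +
  hoop_imp :: "'a \<Rightarrow> 'a \<Rightarrow> 'a"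

definition hoop_congruences :: "('a, 'b) hoop_scheme \<Rightarrow> 'a rel set" where
  "hoop_congruences H = congruences (carrier H) {} {mult H, hoop_imp H}"

abbreviation trivial_hoop :: "('a, 'b) hoop_scheme \<Rightarrow> bool" where
  "trivial_hoop H \<equiv> is_singleton (carrier H)"

abbreviation subdirectly_irreducible_hoop :: "('a, 'b) hoop_scheme \<Rightarrow> bool" where
  "subdirectly_irreducible_hoop H \<equiv> subdirectly_irreducible (carrier H) (hoop_congruences H)"

locale smv_algebra = mv_algebra M for M :: "('a, 'b) mv_alg_scheme" (structure) +
  fixes \<tau> :: "'a \<Rightarrow> 'a"
  assumes tau_closed: "\<tau> \<in> carrier M \<rightarrow> carrier M"
    and tau_one: "\<tau> (mv_one M) = mv_one M"
    and tau_plus: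
      "\<lbrakk>x \<in> carrier M; y \<in> carrier M\<rbrakk> \<Longrightarrow> \<tau> (x \<oplus> y) = \<tau> x \<oplus> \<tau> (y \<ominus> (x \<odot> y))"
    and tau_neg: "x \<in> carrier M \<Longrightarrow> \<tau> (mv_neg M x) = mv_neg M (\<tau> x)"
    and tau_tau_plus:
      "\<lbrakk>x \<in> carrier M; y \<in> carrier M\<rbrakk> \<Longrightarrow> \<tau> (\<tau> x \<oplus> \<tau> y) = \<tau> x \<oplus> \<tau> y"

definition smv_congruences :: "('a, 'b) mv_alg_scheme \<Rightarrow> ('a \<Rightarrow> 'a) \<Rightarrow> 'a rel set" where
  "smv_congruences M \<tau> = congruences (carrier M) {mv_neg M, \<tau>} {mv_plus M}"

abbreviation subdirectly_irreducible_smv ::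
    "('a, 'b) mv_alg_scheme \<Rightarrow> ('a \<Rightarrow> 'a) \<Rightarrow> bool" where
  "subdirectly_irreducible_smv M \<tau> \<equiv>
    subdirectly_irreducible (carrier M) (smv_congruences M \<tau>)"

definition tau_image :: "('a, 'b) mv_alg_scheme \<Rightarrow> ('a \<Rightarrow> 'a) \<Rightarrow> ('a, 'b) mv_alg_scheme" where
  "tau_image M \<tau> = M\<lparr>carrier := \<tau> ` carrier M\<rparr>"

definition tau_filter :: "('a, 'b) mv_alg_scheme \<Rightarrow> ('a \<Rightarrow> 'a) \<Rightarrow> 'a set" where
  "tau_filter M \<tau> = {a \<in> carrier M. \<tau> a = mv_one M}"

definition tau_hoop :: "('a, 'b) mv_alg_scheme \<Rightarrow> ('a \<Rightarrow> 'a) \<Rightarrow> 'a hoop" where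
  "tau_hoop M \<tau> =
    \<lparr>carrier = tau_filter M \<tau>, mult = mv_times M, one = mv_one M, hoop_imp = mv_imp M\<rparr>"

definition disjunction_property :: "('a, 'b) mv_alg_scheme \<Rightarrow> 'a set \<Rightarrow> 'a set \<Rightarrow> bool" where
  "disjunction_property M X Y \<longleftrightarrow>
    (\<forall>x\<in>X. \<forall>y\<in>Y. mv_join M x y = mv_one M \<longrightarrow> x = mv_one M \<or> y = mv_one M)"

end

theory Submission
  imports Defs
begin

text \<open>
  Congruences of MV-algebras, of Wajsberg hoops and of SMV-algebras are determined by the class
  of 1, which is an implicative filter (closed under \<open>\<tau>\<close> in the last case); the congruence is
  recovered by relating \<open>x\<close> and \<open>y\<close> when \<open>x \<leadsto> y\<close> and \<open>y \<leadsto> x\<close> both lie in the filter. So an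
  algebra is subdirectly irreducible iff it has a least filter different from \<open>{1}\<close>
  (\<open>subdirectly_irreducible_iff_least_filter\<close>), and the theorem is a comparison of the
  \<open>\<tau>\<close>-filters of \<open>A\<close> with the filters of \<open>F\<^sub>\<tau>(A)\<close> and of \<open>\<tau>(A)\<close>. Below, least filters are least
  among those different from \<open>{1}\<close>.

  Two transfers make the comparison possible. As \<open>\<tau>\<close> is constantly 1 on \<open>F\<^sub>\<tau>(A)\<close>, the filters of
  that hoop are exactly the \<open>\<tau>\<close>-filters of \<open>A\<close> that it contains. As \<open>\<tau>\<close> is monotone and fixes
  \<open>\<tau>(A)\<close>, the upward closure in \<open>A\<close> of a filter of \<open>\<tau>(A)\<close> is a \<open>\<tau>\<close>-filter with the same trace on
  \<open>\<tau>(A)\<close>. If \<open>F\<^sub>\<tau>(A) = {1}\<close>, then a \<open>\<tau>\<close>-filter other than \<open>{1}\<close> meets \<open>\<tau>(A)\<close> outside 1, because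
  it contains \<open>\<tau> a \<noteq> 1\<close> along with any \<open>a \<noteq> 1\<close>; hence least filters of \<open>A\<close> and of \<open>\<tau>(A)\<close>
  correspond. If \<open>F\<^sub>\<tau>(A) \<noteq> {1}\<close>, a least \<open>\<tau>\<close>-filter is contained in \<open>F\<^sub>\<tau>(A)\<close> and is least there.
  For the converse, a \<open>\<tau>\<close>-filter \<open>G\<close> that meets \<open>F\<^sub>\<tau>(A)\<close> only in 1 would violate the disjunction
  property: if \<open>x \<in> F\<^sub>\<tau>(A)\<close> and \<open>h \<in> G\<close> are different from 1, then so is \<open>\<tau> h\<close>, while the join of
  \<open>x\<close> and \<open>\<tau> h\<close> lies in both filters and is therefore 1.

  Necessity of the disjunction property rests on polars: the elements whose join with every member
  of a fixed set is 1 form a filter. If \<open>x \<in> F\<^sub>\<tau>(A)\<close> and \<open>y \<in> \<tau>(A)\<close> are different from 1 and have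
  join 1, then the polar of \<open>x\<close>, suitably cut down to a \<open>\<tau>\<close>-filter, contains \<open>y\<close> and hence the
  least \<open>\<tau>\<close>-filter \<open>K\<close>. So \<open>x\<close> lies in the polar of \<open>K\<close>; the part of that polar inside \<open>F\<^sub>\<tau>(A)\<close> is
  a \<open>\<tau>\<close>-filter other than \<open>{1}\<close> and contains \<open>K\<close> as well. This forces \<open>k = k \<or> k = 1\<close> for all \<open>k \<in> K\<close>.
\<close>

section \<open>Order and residuation in MV-algebras\<close>

context mv_algebra
begin

abbreviation one_M (\<open>\<^bold>1\<close>) where "\<^bold>1 \<equiv> mv_one M"

definition le (infix \<open>\<preceq>\<close> 50) where
  "x \<preceq> y \<longleftrightarrow> x \<leadsto> y = \<^bold>1"

lemma zero_closed [simp]: "mv_zero M \<in> carrier M"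
  using comm_monoid.axioms(1)[OF plus_comm_monoid] by (simp add: monoid_def)

lemma plus_closed [simp]: "\<lbrakk>x \<in> carrier M; y \<in> carrier M\<rbrakk> \<Longrightarrow> x \<oplus> y \<in> carrier M"
  using comm_monoid.axioms(1)[OF plus_comm_monoid] by (simp add: monoid_def)

lemma plus_assoc:
  "\<lbrakk>x \<in> carrier M; y \<in> carrier M; z \<in> carrier M\<rbrakk> \<Longrightarrow> (x \<oplus> y) \<oplus> z = x \<oplus> (y \<oplus> z)"
  using comm_monoid.axioms(1)[OF plus_comm_monoid] by (simp add: monoid_def)

lemma plus_comm: "\<lbrakk>x \<in> carrier M; y \<in> carrier M\<rbrakk> \<Longrightarrow> x \<oplus> y = y \<oplus> x"
  using comm_monoid.m_comm[OF plus_comm_monoid, of x y] by simp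

lemma plus_zero [simp]: "x \<in> carrier M \<Longrightarrow> x \<oplus> mv_zero M = x"
  using comm_monoid.axioms(1)[OF plus_comm_monoid] by (simp add: monoid_def)

lemma zero_plus [simp]: "x \<in> carrier M \<Longrightarrow> mv_zero M \<oplus> x = x"
  by (metis plus_comm plus_zero zero_closed)

lemmas [simp] = neg_closed neg_neg

lemma one_closed [simp]: "\<^bold>1 \<in> carrier M"
  by (simp add: mv_one_def)

lemma neg_one: "mv_neg M \<^bold>1 = mv_zero M"
  by (simp add: mv_one_def)

lemma imp_closed [simp]: "\<lbrakk>x \<in> carrier M; y \<in> carrier M\<rbrakk> \<Longrightarrow> x \<leadsto> y \<in> carrier M"
  by (simp add: mv_imp_def)

lemma times_closed [simp]: "\<lbrakk>x \<in> carrier M; y \<in> carrier M\<rbrakk> \<Longrightarrow> x \<odot> y \<in> carrier M"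
  by (simp add: mv_times_def)

lemma minus_closed [simp]: "\<lbrakk>x \<in> carrier M; y \<in> carrier M\<rbrakk> \<Longrightarrow> x \<ominus> y \<in> carrier M"
  by (simp add: mv_minus_def)

lemma join_closed [simp]: "\<lbrakk>x \<in> carrier M; y \<in> carrier M\<rbrakk> \<Longrightarrow> mv_join M x y \<in> carrier M"
  by (simp add: mv_join_def)

lemma neg_eq_imp_zero: "x \<in> carrier M \<Longrightarrow> mv_neg M x = x \<leadsto> mv_zero M"
  by (simp add: mv_imp_def)

lemma plus_eq_neg_imp: "x \<in> carrier M \<Longrightarrow> x \<oplus> y = mv_neg M x \<leadsto> y"
  by (simp add: mv_imp_def)

lemma one_imp [simp]: "x \<in> carrier M \<Longrightarrow> \<^bold>1 \<leadsto> x = x"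
  by (simp add: mv_imp_def neg_one)

lemma imp_one [simp]: "x \<in> carrier M \<Longrightarrow> x \<leadsto> \<^bold>1 = \<^bold>1"
  by (simp add: mv_imp_def plus_one)

lemma imp_self [simp]: "x \<in> carrier M \<Longrightarrow> x \<leadsto> x = \<^bold>1"
  using imp_imp_commute[of "\<^bold>1" x] by simp

lemma times_comm: "\<lbrakk>x \<in> carrier M; y \<in> carrier M\<rbrakk> \<Longrightarrow> x \<odot> y = y \<odot> x"
  by (simp add: mv_times_def plus_comm)

lemma times_one [simp]: "x \<in> carrier M \<Longrightarrow> x \<odot> \<^bold>1 = x"
  by (simp add: mv_times_def neg_one)

lemma le_refl [simp]: "x \<in> carrier M \<Longrightarrow> x \<preceq> x"
  by (simp add: le_def)

lemma le_one [simp]: "x \<in> carrier M \<Longrightarrow> x \<preceq> \<^bold>1"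
  by (simp add: le_def)

lemma le_antisym: "\<lbrakk>x \<preceq> y; y \<preceq> x; x \<in> carrier M; y \<in> carrier M\<rbrakk> \<Longrightarrow> x = y"
  using imp_imp_commute[of x y] by (simp add: le_def)

lemma one_le_iff: "x \<in> carrier M \<Longrightarrow> \<^bold>1 \<preceq> x \<longleftrightarrow> x = \<^bold>1"
  by (simp add: le_def)

lemma le_plus: "\<lbrakk>x \<in> carrier M; y \<in> carrier M\<rbrakk> \<Longrightarrow> x \<preceq> x \<oplus> y"
  using plus_one[of y] imp_self[of x] plus_comm[of y "\<^bold>1"]
  by (simp add: le_def mv_imp_def flip: plus_assoc)

text \<open>
  If \<open>x \<leadsto> y = 1\<close>, the axiom \<open>(x \<leadsto> y) \<leadsto> y = (y \<leadsto> x) \<leadsto> x\<close> reads \<open>y = (y \<leadsto> x) \<leadsto> x\<close>, and the right-hand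
  side is a sum with summand \<open>x\<close>. This
  description of the order makes transitivity and the monotonicity laws immediate.
\<close>

lemma le_iff_plus:
  assumes "x \<in> carrier M" "y \<in> carrier M"
  shows "x \<preceq> y \<longleftrightarrow> (\<exists>c\<in>carrier M. y = x \<oplus> c)"
proof
  assume "x \<preceq> y"
  then have "y = (y \<leadsto> x) \<leadsto> x"
    using imp_imp_commute[of x y] assms by (simp add: le_def)
  also have "\<dots> = x \<oplus> mv_neg M (y \<leadsto> x)"
    using assms by (simp add: mv_imp_def plus_comm)
  finally show "\<exists>c\<in>carrier M. y = x \<oplus> c"
    using assms by (metis imp_closed neg_closed)
qed (use assms le_plus in auto)

lemma le_trans:
  assumes "x \<preceq> y" "y \<preceq> z" "x \<in> carrier M" "y \<in> carrier M" "z \<in> carrier M"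
  shows "x \<preceq> z"
  using assms by (metis le_iff_plus plus_assoc plus_closed)

lemma plus_left_mono:
  assumes "x \<preceq> y" "x \<in> carrier M" "y \<in> carrier M" "z \<in> carrier M"
  shows "z \<oplus> x \<preceq> z \<oplus> y"
  using assms by (metis le_iff_plus plus_assoc plus_closed)

lemma neg_le_neg_iff:
  "\<lbrakk>x \<in> carrier M; y \<in> carrier M\<rbrakk> \<Longrightarrow> mv_neg M x \<preceq> mv_neg M y \<longleftrightarrow> y \<preceq> x"
  by (simp add: le_def mv_imp_def plus_comm)

lemma times_imp:
  "\<lbrakk>x \<in> carrier M; y \<in> carrier M; z \<in> carrier M\<rbrakk> \<Longrightarrow> x \<odot> y \<leadsto> z = x \<leadsto> (y \<leadsto> z)"
  by (simp add: mv_imp_def mv_times_def plus_assoc)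

lemma times_le_iff:
  "\<lbrakk>x \<in> carrier M; y \<in> carrier M; z \<in> carrier M\<rbrakk> \<Longrightarrow> x \<odot> y \<preceq> z \<longleftrightarrow> x \<preceq> y \<leadsto> z"
  by (simp add: le_def times_imp)

lemma times_le_iff':
  "\<lbrakk>x \<in> carrier M; y \<in> carrier M; z \<in> carrier M\<rbrakk> \<Longrightarrow> x \<odot> y \<preceq> z \<longleftrightarrow> y \<preceq> x \<leadsto> z"
  by (metis times_comm times_le_iff)

lemma times_le2: "\<lbrakk>x \<in> carrier M; y \<in> carrier M\<rbrakk> \<Longrightarrow> x \<odot> y \<preceq> y"
  by (simp add: times_le_iff)

lemma le_imp: "\<lbrakk>x \<in> carrier M; y \<in> carrier M\<rbrakk> \<Longrightarrow> y \<preceq> x \<leadsto> y"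
  by (metis times_le2 times_le_iff')

lemma times_imp_le: "\<lbrakk>x \<in> carrier M; y \<in> carrier M\<rbrakk> \<Longrightarrow> x \<odot> (x \<leadsto> y) \<preceq> y"
  by (simp add: times_le_iff')

lemma times_left_mono:
  assumes "x \<preceq> y" "x \<in> carrier M" "y \<in> carrier M" "z \<in> carrier M"
  shows "z \<odot> x \<preceq> z \<odot> y"
  using assms by (simp add: mv_times_def neg_le_neg_iff plus_left_mono)

lemma times_mono:
  assumes "a \<preceq> b" "c \<preceq> d" "a \<in> carrier M" "b \<in> carrier M" "c \<in> carrier M" "d \<in> carrier M"
  shows "a \<odot> c \<preceq> b \<odot> d"
proof (rule le_trans)
  show "a \<odot> c \<preceq> a \<odot> d" using assms by (simp add: times_left_mono)
  show "a \<odot> d \<preceq> b \<odot> d" using assms times_left_mono[of a b d] by (simp add: times_comm)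
qed (use assms in auto)

lemma imp_left_antimono:
  assumes "x \<preceq> y" "x \<in> carrier M" "y \<in> carrier M" "z \<in> carrier M"
  shows "y \<leadsto> z \<preceq> x \<leadsto> z"
  using assms by (simp add: mv_imp_def neg_le_neg_iff plus_left_mono plus_comm[of _ z])

lemma times_assoc:
  assumes "x \<in> carrier M" "y \<in> carrier M" "z \<in> carrier M"
  shows "(x \<odot> y) \<odot> z = x \<odot> (y \<odot> z)"
  using assms by (simp add: mv_times_def plus_assoc)

lemma imp_trans:
  assumes "x \<in> carrier M" "y \<in> carrier M" "z \<in> carrier M"
  shows "(x \<leadsto> y) \<odot> (y \<leadsto> z) \<preceq> x \<leadsto> z"
proof -
  have "x \<odot> (x \<leadsto> y) \<odot> (y \<leadsto> z) \<preceq> y \<odot> (y \<leadsto> z)"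
    using assms by (intro times_mono times_imp_le) auto
  then have "x \<odot> (x \<leadsto> y) \<odot> (y \<leadsto> z) \<preceq> z"
    using assms by (blast intro: le_trans times_imp_le times_closed imp_closed)
  then show ?thesis
    using assms by (simp add: times_assoc flip: times_le_iff')
qed

lemma imp_le_times_imp_times:
  assumes "x \<in> carrier M" "y \<in> carrier M" "z \<in> carrier M"
  shows "x \<leadsto> y \<preceq> z \<odot> x \<leadsto> z \<odot> y"
proof -
  have "z \<odot> (x \<odot> (x \<leadsto> y)) \<preceq> z \<odot> y"
    using assms by (intro times_left_mono times_imp_le) auto
  then show ?thesis
    using assms by (simp add: times_assoc flip: times_le_iff')
qed

lemma imp_le_imp_imp_left:
  assumes "x \<in> carrier M" "y \<in> carrier M" "z \<in> carrier M"
  shows "x \<leadsto> y \<preceq> (y \<leadsto> z) \<leadsto> (x \<leadsto> z)"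
  using assms imp_trans by (simp flip: times_le_iff)

lemma imp_le_imp_imp_right:
  assumes "x \<in> carrier M" "y \<in> carrier M" "z \<in> carrier M"
  shows "x \<leadsto> y \<preceq> (z \<leadsto> x) \<leadsto> (z \<leadsto> y)"
  using assms imp_trans by (simp flip: times_le_iff')

lemma le_join1: "\<lbrakk>x \<in> carrier M; y \<in> carrier M\<rbrakk> \<Longrightarrow> x \<preceq> mv_join M x y"
  unfolding mv_join_def by (subst imp_imp_commute) (simp_all add: le_imp)

lemma le_join2: "\<lbrakk>x \<in> carrier M; y \<in> carrier M\<rbrakk> \<Longrightarrow> y \<preceq> mv_join M x y"
  by (simp add: mv_join_def le_imp)

lemma join_least:
  assumes "x \<preceq> z" "y \<preceq> z" "x \<in> carrier M" "y \<in> carrier M" "z \<in> carrier M"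
  shows "mv_join M x y \<preceq> z"
proof -
  have "(x \<leadsto> y) \<leadsto> y \<preceq> (z \<leadsto> y) \<leadsto> y"
    using assms by (intro imp_left_antimono) auto
  also have "(z \<leadsto> y) \<leadsto> y = z"
    using assms imp_imp_commute[of y z] by (simp add: le_def)
  finally show ?thesis by (simp add: mv_join_def)
qed

lemma join_comm: "\<lbrakk>x \<in> carrier M; y \<in> carrier M\<rbrakk> \<Longrightarrow> mv_join M x y = mv_join M y x"
  by (simp add: mv_join_def imp_imp_commute)

lemma join_self [simp]: "x \<in> carrier M \<Longrightarrow> mv_join M x x = x"
  by (simp add: mv_join_def)

lemma one_join [simp]: "x \<in> carrier M \<Longrightarrow> mv_join M \<^bold>1 x = \<^bold>1"
  by (simp add: mv_join_def)

lemma join_one_mono: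
  assumes "mv_join M x z = \<^bold>1" "x \<preceq> y" "x \<in> carrier M" "y \<in> carrier M" "z \<in> carrier M"
  shows "mv_join M y z = \<^bold>1"
proof -
  have "mv_join M x z \<preceq> mv_join M y z"
    using assms by (intro join_least) (auto intro: le_trans[of x y] le_join1 le_join2)
  then show ?thesis using assms by (simp add: one_le_iff)
qed

text \<open>
  Put \<open>w = (x \<odot> y) \<or> z\<close>. Both \<open>y\<close> and \<open>z\<close> lie below \<open>x \<leadsto> w\<close>, hence so does their join 1, which
  gives \<open>x \<preceq> w\<close>. As also \<open>z \<preceq> w\<close>, the join of \<open>x\<close> and \<open>z\<close>, again 1, lies below \<open>w\<close>.
\<close>

lemma join_one_times:
  assumes "mv_join M x z = \<^bold>1" "mv_join M y z = \<^bold>1"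
    and [simp]: "x \<in> carrier M" "y \<in> carrier M" "z \<in> carrier M"
  shows "mv_join M (x \<odot> y) z = \<^bold>1"
proof -
  let ?w = "mv_join M (x \<odot> y) z"
  have z: "z \<preceq> ?w" by (simp add: le_join2)
  have "mv_join M y z \<preceq> x \<leadsto> ?w"
  proof (rule join_least)
    show "y \<preceq> x \<leadsto> ?w" by (simp add: le_join1 flip: times_le_iff')
    show "z \<preceq> x \<leadsto> ?w" using z by (rule le_trans) (simp_all add: le_imp)
  qed simp_all
  then have "x \<preceq> ?w" by (simp add: assms one_le_iff le_def)
  with z have "mv_join M x z \<preceq> ?w" by (intro join_least) auto
  then show ?thesis by (simp add: assms one_le_iff)
qed

section \<open>Filters and congruences of subhoops\<close>

definition subhoop :: "'a set \<Rightarrow> bool" where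
  "subhoop H \<longleftrightarrow> H \<subseteq> carrier M \<and> \<^bold>1 \<in> H \<and> (\<forall>x\<in>H. \<forall>y\<in>H. x \<odot> y \<in> H \<and> x \<leadsto> y \<in> H)"

definition filters :: "'a set \<Rightarrow> 'a set set" where
  "filters H = {F. F \<subseteq> H \<and> \<^bold>1 \<in> F \<and> (\<forall>x\<in>F. \<forall>y\<in>F. x \<odot> y \<in> F) \<and>
     (\<forall>x\<in>F. \<forall>y\<in>H. x \<preceq> y \<longrightarrow> y \<in> F)}"

definition least_nontrivial :: "'a set \<Rightarrow> 'a set set \<Rightarrow> bool" where
  "least_nontrivial K \<F> \<longleftrightarrow> K \<in> \<F> \<and> K \<noteq> {\<^bold>1} \<and> (\<forall>F\<in>\<F>. F \<noteq> {\<^bold>1} \<longrightarrow> K \<subseteq> F)"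

definition filter_cong :: "'a set \<Rightarrow> 'a set \<Rightarrow> 'a rel" where
  "filter_cong H F = {(x, y) \<in> H \<times> H. x \<leadsto> y \<in> F \<and> y \<leadsto> x \<in> F}"

abbreviation hoop_cong :: "'a set \<Rightarrow> 'a rel set" where
  "hoop_cong H \<equiv> congruences H {} {mv_times M, mv_imp M}"

lemma filtersD:
  assumes "F \<in> filters H"
  shows "F \<subseteq> H" "\<^bold>1 \<in> F" "\<And>x y. \<lbrakk>x \<in> F; y \<in> F\<rbrakk> \<Longrightarrow> x \<odot> y \<in> F"
    "\<And>x y. \<lbrakk>x \<preceq> y; x \<in> F; y \<in> H\<rbrakk> \<Longrightarrow> y \<in> F"
  using assms unfolding filters_def by blast+

lemma subhoopD:
  assumes "subhoop H"
  shows "\<And>x. x \<in> H \<Longrightarrow> x \<in> carrier M" "\<^bold>1 \<in> H"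
    "\<And>x y. \<lbrakk>x \<in> H; y \<in> H\<rbrakk> \<Longrightarrow> x \<odot> y \<in> H" "\<And>x y. \<lbrakk>x \<in> H; y \<in> H\<rbrakk> \<Longrightarrow> x \<leadsto> y \<in> H"
  using assms by (auto simp: subhoop_def)

lemma subhoop_carrier: "subhoop (carrier M)"
  by (simp add: subhoop_def)

text \<open>
  The operations of either signature are compositions of those of the other, because
  \<open>\<not>x = x \<leadsto> 0\<close> and \<open>x \<oplus> y = \<not>x \<leadsto> y\<close>. This reduces all three kinds of congruences to one.
\<close>

lemma mv_congruences_eq_hoop_cong:
  assumes H: "subhoop H" and zero: "mv_zero M \<in> H"
    and neg: "\<And>x. x \<in> H \<Longrightarrow> mv_neg M x \<in> H"
  shows "congruences H {mv_neg M} {mv_plus M} = hoop_cong H"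
proof (intro equalityI subsetI)
  fix \<theta> assume "\<theta> \<in> congruences H {mv_neg M} {mv_plus M}"
  then have eq: "equiv H \<theta>"
    and n: "\<And>x y. (x, y) \<in> \<theta> \<Longrightarrow> (mv_neg M x, mv_neg M y) \<in> \<theta>"
    and p: "\<And>x y u v. \<lbrakk>(x, y) \<in> \<theta>; (u, v) \<in> \<theta>\<rbrakk> \<Longrightarrow> (x \<oplus> u, y \<oplus> v) \<in> \<theta>"
    by (auto simp: congruences_def)
  have "(x \<odot> u, y \<odot> v) \<in> \<theta> \<and> (x \<leadsto> u, y \<leadsto> v) \<in> \<theta>" if "(x, y) \<in> \<theta>" "(u, v) \<in> \<theta>" for x y u v
    using that by (simp add: mv_times_def mv_imp_def n p)
  with eq show "\<theta> \<in> hoop_cong H" by (auto simp: congruences_def)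
next
  fix \<theta> assume "\<theta> \<in> hoop_cong H"
  then have eq: "equiv H \<theta>"
    and i: "\<And>x y u v. \<lbrakk>(x, y) \<in> \<theta>; (u, v) \<in> \<theta>\<rbrakk> \<Longrightarrow> (x \<leadsto> u, y \<leadsto> v) \<in> \<theta>"
    by (auto simp: congruences_def)
  have in_H: "x \<in> carrier M" "y \<in> carrier M" if "(x, y) \<in> \<theta>" for x y
    using eq that subhoopD(1)[OF H] by (auto simp: equiv_def)
  have zz: "(mv_zero M, mv_zero M) \<in> \<theta>"
    using eq zero by (simp add: equiv_def refl_on_def)
  have n: "(mv_neg M x, mv_neg M y) \<in> \<theta>" if "(x, y) \<in> \<theta>" for x y
    using i[OF that zz] in_H[OF that] by (simp add: neg_eq_imp_zero)
  have "(x \<oplus> u, y \<oplus> v) \<in> \<theta>" if "(x, y) \<in> \<theta>" "(u, v) \<in> \<theta>" for x y u v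
    using i[OF n[OF that(1)] that(2)] in_H[OF that(1)] by (simp add: plus_eq_neg_imp)
  with eq n show "\<theta> \<in> congruences H {mv_neg M} {mv_plus M}" by (auto simp: congruences_def)
qed

text \<open>
  Transitivity and compatibility come from inequalities with an implication, or a product of
  implications, on the left: as the filter is upward closed, it inherits the right-hand side.
\<close>

lemma filter_cong_in_hoop_cong:
  assumes H: "subhoop H" and F: "F \<in> filters H"
  shows "filter_cong H F \<in> hoop_cong H"
proof -
  note h = subhoopD[OF H] and f = filtersD[OF F]
  let ?\<theta> = "filter_cong H F"
  have up: "b \<in> F" if "a \<preceq> b" "a \<in> F" "b \<in> H" for a b
    using that by (rule f(4))
  have imp: "x \<leadsto> z \<in> F"
    if "x \<in> H" "y \<in> H" "z \<in> H" "x \<leadsto> y \<in> F" "y \<leadsto> z \<in> F" for x y z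
    using that by (intro up[OF imp_trans[of x y z]] f(3) h)
  have trans: "(x, z) \<in> ?\<theta>" if "(x, y) \<in> ?\<theta>" "(y, z) \<in> ?\<theta>" for x y z
    using that imp by (simp add: filter_cong_def) blast
  have "refl_on H ?\<theta>"
    using h(1) f(2) by (simp add: refl_on_def filter_cong_def)
  moreover have "sym ?\<theta>" "?\<theta> \<subseteq> H \<times> H"
    by (auto simp: sym_def filter_cong_def)
  moreover have "trans ?\<theta>"
    using trans by (rule transI)
  ultimately have eq: "equiv H ?\<theta>"
    by (simp add: equiv_def)
  \<comment> \<open>By transitivity it is enough to vary one argument at a time.\<close>
  have r: "(z \<odot> x, z \<odot> y) \<in> ?\<theta>" "(x \<odot> z, y \<odot> z) \<in> ?\<theta>"
      "(z \<leadsto> x, z \<leadsto> y) \<in> ?\<theta>" "(x \<leadsto> z, y \<leadsto> z) \<in> ?\<theta>"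
    if "(x, y) \<in> ?\<theta>" and z: "z \<in> H" for x y z
  proof -
    have xy: "x \<in> H" "y \<in> H" "x \<leadsto> y \<in> F" "y \<leadsto> x \<in> F"
      using that(1) by (auto simp: filter_cong_def)
    note c = xy(1,2) z
    have "z \<odot> x \<leadsto> z \<odot> y \<in> F" "z \<odot> y \<leadsto> z \<odot> x \<in> F"
      using c xy by (blast intro: up[OF imp_le_times_imp_times] h)+
    then show "(z \<odot> x, z \<odot> y) \<in> ?\<theta>"
      using c h(3) by (simp add: filter_cong_def)
    then show "(x \<odot> z, y \<odot> z) \<in> ?\<theta>"
      using c h(1) by (simp add: times_comm[of _ z])
    have "(z \<leadsto> x) \<leadsto> (z \<leadsto> y) \<in> F" "(z \<leadsto> y) \<leadsto> (z \<leadsto> x) \<in> F"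
      using c xy by (blast intro: up[OF imp_le_imp_imp_right] h)+
    then show "(z \<leadsto> x, z \<leadsto> y) \<in> ?\<theta>"
      using c h(4) by (simp add: filter_cong_def)
    have "(x \<leadsto> z) \<leadsto> (y \<leadsto> z) \<in> F" "(y \<leadsto> z) \<leadsto> (x \<leadsto> z) \<in> F"
      using c xy by (blast intro: up[OF imp_le_imp_imp_left] h)+
    then show "(x \<leadsto> z, y \<leadsto> z) \<in> ?\<theta>"
      using c h(4) by (simp add: filter_cong_def)
  qed
  have "(x \<odot> u, y \<odot> v) \<in> ?\<theta> \<and> (x \<leadsto> u, y \<leadsto> v) \<in> ?\<theta>"
    if "(x, y) \<in> ?\<theta>" "(u, v) \<in> ?\<theta>" for x y u v
  proof -
    have "u \<in> H" "y \<in> H" using that by (simp_all add: filter_cong_def)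
    then show ?thesis
      using trans[OF r(2)[OF that(1)] r(1)[OF that(2)]]
        trans[OF r(4)[OF that(1)] r(3)[OF that(2)]] by simp
  qed
  with eq show ?thesis by (auto simp: congruences_def)
qed

lemma one_class_filter_cong:
  assumes H: "subhoop H" and F: "F \<in> filters H"
  shows "filter_cong H F `` {\<^bold>1} = F"
proof -
  note h = subhoopD[OF H] and f = filtersD[OF F]
  have "(\<^bold>1, x) \<in> filter_cong H F \<longleftrightarrow> x \<in> F" for x
  proof (cases "x \<in> H")
    case True
    then show ?thesis using h(1)[of x] h(2) f(2) by (simp add: filter_cong_def)
  next
    case False
    then show ?thesis using f(1) by (auto simp: filter_cong_def)
  qed
  then show ?thesis by auto
qed

lemma filter_cong_mono: "F \<subseteq> G \<Longrightarrow> filter_cong H F \<subseteq> filter_cong H G"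
  by (auto simp: filter_cong_def)

lemma filter_cong_one:
  assumes H: "subhoop H" shows "filter_cong H {\<^bold>1} = Id_on H"
proof -
  have "x = y" if "x \<in> H" "y \<in> H" "x \<leadsto> y = \<^bold>1" "y \<leadsto> x = \<^bold>1" for x y
    using that le_antisym[of x y] subhoopD(1)[OF H] by (simp add: le_def)
  then show ?thesis using subhoopD(1)[OF H] by (auto simp: filter_cong_def)
qed

lemma one_class_in_filters:
  assumes H: "subhoop H" and \<theta>: "\<theta> \<in> hoop_cong H"
  shows "\<theta> `` {\<^bold>1} \<in> filters H"
proof -
  note h = subhoopD[OF H]
  have eq: "equiv H \<theta>"
    and t: "\<And>x y u v. \<lbrakk>(x, y) \<in> \<theta>; (u, v) \<in> \<theta>\<rbrakk> \<Longrightarrow> (x \<odot> u, y \<odot> v) \<in> \<theta>"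
    and i: "\<And>x y u v. \<lbrakk>(x, y) \<in> \<theta>; (u, v) \<in> \<theta>\<rbrakk> \<Longrightarrow> (x \<leadsto> u, y \<leadsto> v) \<in> \<theta>"
    using \<theta> by (auto simp: congruences_def)
  have sub: "\<theta> \<subseteq> H \<times> H" and rfl: "\<And>x. x \<in> H \<Longrightarrow> (x, x) \<in> \<theta>"
    and symm: "\<And>x y. (x, y) \<in> \<theta> \<Longrightarrow> (y, x) \<in> \<theta>"
    using eq by (auto simp: equiv_def refl_on_def sym_def)
  have "(\<^bold>1, y) \<in> \<theta>" if "(\<^bold>1, x) \<in> \<theta>" "y \<in> H" "x \<preceq> y" for x y
    \<comment> \<open>Apply \<open>_ \<leadsto> y\<close> to \<open>x\<close> and 1: the results are 1 and \<open>y\<close>.\<close>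
    using symm[OF i[OF that(1) rfl[OF that(2)]]] that h by (simp add: le_def)
  moreover have "(\<^bold>1, x \<odot> y) \<in> \<theta>" if "(\<^bold>1, x) \<in> \<theta>" "(\<^bold>1, y) \<in> \<theta>" for x y
    using t[OF that] by simp
  ultimately show ?thesis
    using sub rfl h by (auto simp: filters_def)
qed

text \<open>
  If \<open>x \<leadsto> y\<close> and \<open>y \<leadsto> x\<close> are congruent to 1, then \<open>(x \<leadsto> y) \<leadsto> y\<close> is congruent to \<open>y\<close> and
  \<open>(y \<leadsto> x) \<leadsto> x\<close> to \<open>x\<close>; these two elements are equal, so \<open>x\<close> and \<open>y\<close> are congruent.
\<close>

lemma filter_cong_one_class:
  assumes H: "subhoop H" and \<theta>: "\<theta> \<in> hoop_cong H"
  shows "filter_cong H (\<theta> `` {\<^bold>1}) = \<theta>"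
proof -
  note h = subhoopD[OF H]
  have eq: "equiv H \<theta>"
    and i: "\<And>x y u v. \<lbrakk>(x, y) \<in> \<theta>; (u, v) \<in> \<theta>\<rbrakk> \<Longrightarrow> (x \<leadsto> u, y \<leadsto> v) \<in> \<theta>"
    using \<theta> by (auto simp: congruences_def)
  have sub: "\<theta> \<subseteq> H \<times> H" and rfl: "\<And>x. x \<in> H \<Longrightarrow> (x, x) \<in> \<theta>"
    and symm: "\<And>x y. (x, y) \<in> \<theta> \<Longrightarrow> (y, x) \<in> \<theta>"
    and trans: "\<And>x y z. \<lbrakk>(x, y) \<in> \<theta>; (y, z) \<in> \<theta>\<rbrakk> \<Longrightarrow> (x, z) \<in> \<theta>"
    using eq by (auto simp: equiv_def refl_on_def sym_def dest: transD)
  have "(\<^bold>1, x \<leadsto> y) \<in> \<theta>" if "(x, y) \<in> \<theta>" for x y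
    using i[OF rfl that, of x] that sub h by auto
  moreover have "(x, y) \<in> \<theta>"
    if "x \<in> H" "y \<in> H" "(\<^bold>1, x \<leadsto> y) \<in> \<theta>" "(\<^bold>1, y \<leadsto> x) \<in> \<theta>" for x y
  proof -
    have "(y, (x \<leadsto> y) \<leadsto> y) \<in> \<theta>" using i[OF that(3) rfl[OF that(2)]] that h by simp
    moreover have "(x, (y \<leadsto> x) \<leadsto> x) \<in> \<theta>" using i[OF that(4) rfl[OF that(1)]] that h by simp
    ultimately show ?thesis
      using imp_imp_commute[of x y] that h trans symm by metis
  qed
  ultimately show ?thesis
    using sub symm by (auto simp: filter_cong_def)
qed

text \<open>
  The set \<open>Con\<close> is left open because the congruences of an SMV-algebra are only some of the hoop
  congruences, namely those whose filters are closed under \<open>\<tau>\<close>.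
\<close>

lemma subdirectly_irreducible_iff_least_filter:
  assumes H: "subhoop H" and Con: "Con \<subseteq> hoop_cong H"
  shows "subdirectly_irreducible H Con \<longleftrightarrow>
    (\<exists>K. least_nontrivial K {F \<in> filters H. filter_cong H F \<in> Con})"
  (is "_ = (\<exists>K. least_nontrivial K ?\<F>)")
proof
  assume "subdirectly_irreducible H Con"
  then obtain \<mu> where \<mu>: "\<mu> \<in> Con" "\<mu> \<noteq> Id_on H"
    and least: "\<And>\<theta>. \<lbrakk>\<theta> \<in> Con; \<theta> \<noteq> Id_on H\<rbrakk> \<Longrightarrow> \<mu> \<subseteq> \<theta>"
    by (auto simp: subdirectly_irreducible_def)
  have \<mu>H: "\<mu> \<in> hoop_cong H" using \<mu> Con by blast
  note recover = filter_cong_one_class[OF H \<mu>H]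
  have "\<mu> `` {\<^bold>1} \<subseteq> F" if F: "F \<in> ?\<F>" and "F \<noteq> {\<^bold>1}" for F
  proof -
    have "filter_cong H F \<noteq> Id_on H"
    proof
      assume "filter_cong H F = Id_on H"
      then have "F = Id_on H `` {\<^bold>1}" using one_class_filter_cong[OF H, of F] F by simp
      then show False using that subhoopD(2)[OF H] by auto
    qed
    then have "\<mu> \<subseteq> filter_cong H F" using least F by blast
    then show ?thesis using one_class_filter_cong[OF H, of F] F by blast
  qed
  moreover have "\<mu> `` {\<^bold>1} \<noteq> {\<^bold>1}"
    using recover \<mu>(2) filter_cong_one[OF H] by metis
  ultimately have "least_nontrivial (\<mu> `` {\<^bold>1}) ?\<F>"
    using one_class_in_filters[OF H \<mu>H] recover \<mu>(1) by (auto simp: least_nontrivial_def)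
  then show "\<exists>K. least_nontrivial K ?\<F>" ..
next
  assume "\<exists>K. least_nontrivial K ?\<F>"
  then obtain K where K: "K \<in> filters H" "filter_cong H K \<in> Con" "K \<noteq> {\<^bold>1}"
    and least: "\<And>F. \<lbrakk>F \<in> ?\<F>; F \<noteq> {\<^bold>1}\<rbrakk> \<Longrightarrow> K \<subseteq> F"
    by (auto simp: least_nontrivial_def)
  have "filter_cong H K \<noteq> Id_on H"
    using one_class_filter_cong[OF H K(1)] K(3) subhoopD(2)[OF H] by auto
  moreover have "filter_cong H K \<subseteq> \<theta>" if \<theta>: "\<theta> \<in> Con" "\<theta> \<noteq> Id_on H" for \<theta>
  proof -
    have \<theta>H: "\<theta> \<in> hoop_cong H" using \<theta> Con by blast
    note recover = filter_cong_one_class[OF H \<theta>H]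
    have "\<theta> `` {\<^bold>1} \<noteq> {\<^bold>1}" using recover \<theta>(2) filter_cong_one[OF H] by metis
    then have "K \<subseteq> \<theta> `` {\<^bold>1}"
      using least one_class_in_filters[OF H \<theta>H] recover \<theta>(1) by simp
    then show ?thesis using filter_cong_mono recover by metis
  qed
  moreover have "\<not> is_singleton H"
    using K(3) filtersD(1,2)[OF K(1)] by (auto simp: is_singleton_def)
  ultimately show "subdirectly_irreducible H Con"
    using K(2) unfolding subdirectly_irreducible_def by blast
qed

text \<open>Also known as the co-annihilator of \<open>X\<close>.\<close>

definition polar :: "'a set \<Rightarrow> 'a set" where
  "polar X = {a \<in> carrier M. \<forall>x\<in>X. mv_join M a x = \<^bold>1}"

lemma polar_in_filters: "X \<subseteq> carrier M \<Longrightarrow> polar X \<in> filters (carrier M)"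
  by (auto simp: polar_def filters_def subset_iff intro: join_one_times join_one_mono)

lemma polar_self: "\<lbrakk>X \<subseteq> carrier M; X \<subseteq> polar X\<rbrakk> \<Longrightarrow> X \<subseteq> {\<^bold>1}"
  by (auto simp: polar_def subset_iff) (metis join_self)

lemma filters_Int: "\<lbrakk>F \<in> filters H; G \<in> filters H\<rbrakk> \<Longrightarrow> F \<inter> G \<in> filters H"
  by (auto simp: filters_def)

end

section \<open>The state operator and its filters\<close>

context smv_algebra
begin

lemma tau_in [simp]: "x \<in> carrier M \<Longrightarrow> \<tau> x \<in> carrier M"
  using tau_closed by blast

lemma tau_zero: "\<tau> (mv_zero M) = mv_zero M"
  using tau_neg[of "\<^bold>1"] by (simp add: tau_one neg_one)

lemma tau_tau: "x \<in> carrier M \<Longrightarrow> \<tau> (\<tau> x) = \<tau> x"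
  using tau_tau_plus[of x "mv_zero M"] by (simp add: tau_zero)

lemma tau_mono:
  assumes "x \<preceq> y" "x \<in> carrier M" "y \<in> carrier M"
  shows "\<tau> x \<preceq> \<tau> y"
  using assms by (auto simp: le_iff_plus[of x y] tau_plus le_plus)

text \<open>
  The additivity axiom makes \<open>\<tau> (x \<oplus> y)\<close> the sum of \<open>\<tau> x\<close> and the value at an element below \<open>y\<close>, so
  \<open>\<tau>\<close> is subadditive. By duality it is supermultiplicative, which gives \<open>\<tau> (x \<leadsto> y) \<preceq> \<tau> x \<leadsto> \<tau> y\<close>:
  this is what lets a \<open>\<tau>\<close>-closed filter induce a \<open>\<tau>\<close>-compatible congruence.
\<close>

lemma tau_plus_le:
  assumes [simp]: "x \<in> carrier M" "y \<in> carrier M"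
  shows "\<tau> (x \<oplus> y) \<preceq> \<tau> x \<oplus> \<tau> y"
proof -
  have "mv_neg M (mv_neg M y \<oplus> x \<odot> y) \<preceq> mv_neg M (mv_neg M y)"
    by (subst neg_le_neg_iff) (simp_all add: le_plus)
  then have "y \<ominus> (x \<odot> y) \<preceq> y" by (simp add: mv_minus_def)
  then show ?thesis by (simp add: tau_plus plus_left_mono tau_mono)
qed

lemma tau_times_ge:
  assumes [simp]: "x \<in> carrier M" "y \<in> carrier M"
  shows "\<tau> x \<odot> \<tau> y \<preceq> \<tau> (x \<odot> y)"
  using tau_plus_le[of "mv_neg M x" "mv_neg M y"]
  by (simp add: mv_times_def tau_neg neg_le_neg_iff)

lemma tau_imp_le:
  assumes [simp]: "x \<in> carrier M" "y \<in> carrier M"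
  shows "\<tau> (x \<leadsto> y) \<preceq> \<tau> x \<leadsto> \<tau> y"
proof -
  have "\<tau> x \<odot> \<tau> (x \<leadsto> y) \<preceq> \<tau> (x \<odot> (x \<leadsto> y))" by (simp add: tau_times_ge)
  moreover have "\<tau> (x \<odot> (x \<leadsto> y)) \<preceq> \<tau> y" by (simp add: tau_mono times_imp_le)
  ultimately have "\<tau> x \<odot> \<tau> (x \<leadsto> y) \<preceq> \<tau> y" by (rule le_trans) simp_all
  then show ?thesis by (simp add: times_le_iff')
qed

definition tau_filters :: "'a set set" where
  "tau_filters = {F \<in> filters (carrier M). \<tau> ` F \<subseteq> F}"

lemma tau_vimage_in_filters:
  assumes F: "F \<in> filters (carrier M)"
  shows "{a \<in> carrier M. \<tau> a \<in> F} \<in> filters (carrier M)"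
proof -
  note f = filtersD[OF F]
  have "\<tau> (x \<odot> y) \<in> F" if "x \<in> carrier M" "y \<in> carrier M" "\<tau> x \<in> F" "\<tau> y \<in> F" for x y
    using that f(4)[OF tau_times_ge[of x y]] f(3) by simp
  moreover have "\<tau> y \<in> F" if "x \<in> carrier M" "y \<in> carrier M" "\<tau> x \<in> F" "x \<preceq> y" for x y
    using that f(4)[OF tau_mono[of x y]] by simp
  ultimately show ?thesis using f(2) by (auto simp: filters_def tau_one)
qed

text \<open>
  The preimage of a filter under \<open>\<tau>\<close> need not lie in the filter, but the intersection of the two is
  closed under \<open>\<tau>\<close> because \<open>\<tau>\<close> is idempotent. It still contains every fixed point of \<open>\<tau>\<close> in the
  given filter.
\<close>

lemma tau_vimage_Int_in_tau_filters:
  assumes F: "F \<in> filters (carrier M)"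
  shows "F \<inter> {a \<in> carrier M. \<tau> a \<in> F} \<in> tau_filters"
  using filters_Int[OF F tau_vimage_in_filters[OF F]]
  by (auto simp: tau_filters_def tau_tau)

lemma tau_filter_in_tau_filters: "tau_filter M \<tau> \<in> tau_filters"
proof -
  have "{\<^bold>1} \<in> filters (carrier M)" by (auto simp: filters_def one_le_iff)
  from tau_vimage_in_filters[OF this] show ?thesis
    by (auto simp: tau_filters_def tau_filter_def tau_tau tau_one)
qed

lemma filter_cong_in_smv_congruences_iff:
  assumes F: "F \<in> filters (carrier M)"
  shows "filter_cong (carrier M) F \<in> smv_congruences M \<tau> \<longleftrightarrow> \<tau> ` F \<subseteq> F"
proof
  let ?\<theta> = "filter_cong (carrier M) F"
  note f = filtersD[OF F] and cls = one_class_filter_cong[OF subhoop_carrier F]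
  {
    assume "?\<theta> \<in> smv_congruences M \<tau>"
    then have t: "(\<tau> x, \<tau> y) \<in> ?\<theta>" if "(x, y) \<in> ?\<theta>" for x y
      using that by (auto simp: smv_congruences_def congruences_def)
    show "\<tau> ` F \<subseteq> F"
      using t[of "\<^bold>1"] cls by (force simp: tau_one)
  next
    assume tF: "\<tau> ` F \<subseteq> F"
    have "(\<tau> x, \<tau> y) \<in> ?\<theta>" if "(x, y) \<in> ?\<theta>" for x y
      using that tF f(4)[OF tau_imp_le[of x y]] f(4)[OF tau_imp_le[of y x]]
      by (auto simp: filter_cong_def)
    moreover have "?\<theta> \<in> congruences (carrier M) {mv_neg M} {mv_plus M}"
      using filter_cong_in_hoop_cong[OF subhoop_carrier F]
        mv_congruences_eq_hoop_cong[OF subhoop_carrier] by simp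
    ultimately show "?\<theta> \<in> smv_congruences M \<tau>"
      by (auto simp: smv_congruences_def congruences_def)
  }
qed

lemma neg_in_tau_image: "x \<in> \<tau> ` carrier M \<Longrightarrow> mv_neg M x \<in> \<tau> ` carrier M"
  by (auto simp flip: tau_neg)

lemma subhoop_tau_image: "subhoop (\<tau> ` carrier M)"
proof -
  have p: "x \<oplus> y \<in> \<tau> ` carrier M" if xy: "x \<in> \<tau> ` carrier M" "y \<in> \<tau> ` carrier M" for x y
  proof -
    obtain a b where ab: "a \<in> carrier M" "b \<in> carrier M" and eq: "x = \<tau> a" "y = \<tau> b"
      using xy by blast
    have "\<tau> (x \<oplus> y) = x \<oplus> y" unfolding eq using ab by (rule tau_tau_plus)
    moreover have "x \<oplus> y \<in> carrier M" using ab eq by simp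
    ultimately show ?thesis by (metis image_eqI)
  qed
  show ?thesis
    using p neg_in_tau_image image_eqI[of "\<^bold>1" \<tau> "\<^bold>1" "carrier M"] tau_one
    by (auto simp: subhoop_def mv_times_def mv_imp_def)
qed

lemma subhoop_tau_filter: "subhoop (tau_filter M \<tau>)"
proof -
  have F: "tau_filter M \<tau> \<in> filters (carrier M)"
    using tau_filter_in_tau_filters by (simp add: tau_filters_def)
  note f = filtersD[OF F]
  have "x \<leadsto> y \<in> tau_filter M \<tau>" if "x \<in> tau_filter M \<tau>" "y \<in> tau_filter M \<tau>" for x y
    using that f(1) f(4)[OF le_imp[of x y]] by auto
  then show ?thesis using f by (auto simp: subhoop_def)
qed

lemma subdirectly_irreducible_smv_iff:
  "subdirectly_irreducible_smv M \<tau> \<longleftrightarrow> (\<exists>K. least_nontrivial K tau_filters)"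
proof -
  have "smv_congruences M \<tau> \<subseteq> congruences (carrier M) {mv_neg M} {mv_plus M}"
    by (auto simp: smv_congruences_def congruences_def)
  then have "smv_congruences M \<tau> \<subseteq> hoop_cong (carrier M)"
    using mv_congruences_eq_hoop_cong[OF subhoop_carrier] by simp
  moreover have "{F \<in> filters (carrier M). filter_cong (carrier M) F \<in> smv_congruences M \<tau>} = tau_filters"
    unfolding tau_filters_def
    by (simp add: filter_cong_in_smv_congruences_iff cong: conj_cong)
  ultimately show ?thesis
    using subdirectly_irreducible_iff_least_filter[OF subhoop_carrier, of "smv_congruences M \<tau>"]
    by simp
qed

lemma subdirectly_irreducible_iff_hoop_cong:
  assumes "subhoop H"
  shows "subdirectly_irreducible H (hoop_cong H) \<longleftrightarrow> (\<exists>K. least_nontrivial K (filters H))"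
proof -
  have "{F \<in> filters H. filter_cong H F \<in> hoop_cong H} = filters H"
    using filter_cong_in_hoop_cong[OF assms] by blast
  then show ?thesis
    using subdirectly_irreducible_iff_least_filter[OF assms order_refl] by simp
qed

lemma subdirectly_irreducible_tau_image_iff:
  "subdirectly_irreducible_mv (tau_image M \<tau>) \<longleftrightarrow>
    (\<exists>K. least_nontrivial K (filters (\<tau> ` carrier M)))"
proof -
  have "mv_congruences (tau_image M \<tau>) = congruences (\<tau> ` carrier M) {mv_neg M} {mv_plus M}"
    by (simp add: mv_congruences_def tau_image_def)
  also have "\<dots> = hoop_cong (\<tau> ` carrier M)"
  proof (rule mv_congruences_eq_hoop_cong[OF subhoop_tau_image])
    show "mv_zero M \<in> \<tau> ` carrier M" using tau_zero by (metis image_eqI zero_closed)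
    show "mv_neg M x \<in> \<tau> ` carrier M" if "x \<in> \<tau> ` carrier M" for x
      using that by (rule neg_in_tau_image)
  qed
  finally show ?thesis
    using subdirectly_irreducible_iff_hoop_cong[OF subhoop_tau_image] by (simp add: tau_image_def)
qed

lemma subdirectly_irreducible_tau_hoop_iff:
  "subdirectly_irreducible_hoop (tau_hoop M \<tau>) \<longleftrightarrow>
    (\<exists>K. least_nontrivial K (filters (tau_filter M \<tau>)))"
  using subdirectly_irreducible_iff_hoop_cong[OF subhoop_tau_filter]
  by (simp add: hoop_congruences_def tau_hoop_def)

text \<open>
  The closure under \<open>\<tau>\<close> costs nothing inside \<open>F\<^sub>\<tau>(A)\<close>, where \<open>\<tau>\<close> takes only the value 1; and as
  \<open>F\<^sub>\<tau>(A)\<close> is upward closed in \<open>A\<close>, so are its filters.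
\<close>

lemma filters_tau_filter_iff:
  "F \<in> filters (tau_filter M \<tau>) \<longleftrightarrow> F \<in> tau_filters \<and> F \<subseteq> tau_filter M \<tau>"
proof -
  have T: "tau_filter M \<tau> \<in> filters (carrier M)"
    using tau_filter_in_tau_filters by (simp add: tau_filters_def)
  note t = filtersD[OF T]
  show ?thesis
  proof
    assume F: "F \<in> filters (tau_filter M \<tau>)"
    note f = filtersD[OF F]
    have "y \<in> F" if "x \<preceq> y" "x \<in> F" "y \<in> carrier M" for x y
      using that f t by blast
    moreover have "\<tau> x \<in> F" if "x \<in> F" for x
      using that f(1,2) by (auto simp: tau_filter_def)
    ultimately show "F \<in> tau_filters \<and> F \<subseteq> tau_filter M \<tau>"
      using f t(1) by (auto simp: tau_filters_def filters_def)
  next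
    assume "F \<in> tau_filters \<and> F \<subseteq> tau_filter M \<tau>"
    then show "F \<in> filters (tau_filter M \<tau>)"
      using t(1) by (auto simp: tau_filters_def filters_def)
  qed
qed

section \<open>Transfer of least filters\<close>

definition up_closure :: "'a set \<Rightarrow> 'a set" where
  "up_closure K = {a \<in> carrier M. \<exists>k\<in>K. k \<preceq> a}"

text \<open>
  No products have to be added, since \<open>K\<close> is closed under them. If \<open>k \<preceq> a\<close> with \<open>k \<in> K\<close>, then
  \<open>k = \<tau> k \<preceq> \<tau> a\<close>, which gives the closure under \<open>\<tau>\<close>.
\<close>

lemma up_closure_in_tau_filters:
  assumes K: "K \<in> filters (\<tau> ` carrier M)"
  shows "up_closure K \<in> tau_filters"
proof -
  note k = filtersD[OF K]
  have kM: "x \<in> carrier M" and fix_tau: "\<tau> x = x" if "x \<in> K" for x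
    using that k(1) by (auto simp: tau_tau)
  have "\<exists>k\<in>K. k \<preceq> x \<odot> y"
    if "x \<in> carrier M" "y \<in> carrier M" "u \<in> K" "u \<preceq> x" "v \<in> K" "v \<preceq> y" for x y u v
    using that k(3) kM by (intro bexI[of _ "u \<odot> v"] times_mono) auto
  moreover have "\<exists>k\<in>K. k \<preceq> y"
    if "x \<in> carrier M" "y \<in> carrier M" "u \<in> K" "u \<preceq> x" "x \<preceq> y" for x y u
    using that kM le_trans by blast
  moreover have "\<exists>k\<in>K. k \<preceq> \<tau> x" if "x \<in> carrier M" "u \<in> K" "u \<preceq> x" for x u
    using that kM fix_tau tau_mono[of u x] by auto
  moreover have "\<exists>k\<in>K. k \<preceq> \<^bold>1" using k(2) by (intro bexI[of _ "\<^bold>1"]) auto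
  ultimately show ?thesis
    unfolding up_closure_def tau_filters_def filters_def by auto
qed

lemma up_closure_superset:
  assumes "K \<subseteq> carrier M" shows "K \<subseteq> up_closure K"
proof
  fix x assume "x \<in> K"
  then have "x \<in> carrier M" "x \<preceq> x" using assms by auto
  then show "x \<in> up_closure K" using \<open>x \<in> K\<close> unfolding up_closure_def by blast
qed

lemma up_closure_Int:
  assumes "K \<in> filters (\<tau> ` carrier M)"
  shows "up_closure K \<inter> \<tau> ` carrier M \<subseteq> K"
  using filtersD(4)[OF assms] unfolding up_closure_def by blast

lemma tau_filters_Int_tau_image:
  assumes "F \<in> tau_filters"
  shows "F \<inter> \<tau> ` carrier M \<in> filters (\<tau> ` carrier M)"
proof -
  have F: "F \<in> filters (carrier M)" using assms by (simp add: tau_filters_def)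
  note f = filtersD[OF F] and h = subhoopD[OF subhoop_tau_image]
  have "y \<in> F" if "x \<preceq> y" "x \<in> F" "y \<in> \<tau> ` carrier M" for x y
    using that(1,2) h(1)[OF that(3)] by (rule f(4))
  then show ?thesis unfolding filters_def using f(2,3) h(2,3) by blast
qed

text \<open>
  Intersection with \<open>\<tau>(A)\<close> and upward closure in \<open>A\<close> preserve inclusion and, since only 1 has
  \<open>\<tau>\<close>-value 1, being different from \<open>{1}\<close>. Each carries a least filter on one side to a least one on
  the other.
\<close>

lemma least_nontrivial_tau_image_iff:
  assumes triv: "tau_filter M \<tau> = {\<^bold>1}"
  shows "(\<exists>K. least_nontrivial K tau_filters) \<longleftrightarrow>
    (\<exists>K. least_nontrivial K (filters (\<tau> ` carrier M)))"
proof -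
  let ?T = "\<tau> ` carrier M"
  have sub: "F \<subseteq> carrier M" "\<^bold>1 \<in> F" if "F \<in> tau_filters" for F
    using that by (auto simp: tau_filters_def filters_def)
  have one_T: "\<^bold>1 \<in> ?T" by (rule subhoopD(2)[OF subhoop_tau_image])
  have trace: "F \<inter> ?T \<noteq> {\<^bold>1}" if F: "F \<in> tau_filters" and ne: "F \<noteq> {\<^bold>1}" for F
  proof -
    obtain a where a: "a \<in> F" "a \<noteq> \<^bold>1" using ne sub(2)[OF F] by blast
    then have "a \<in> carrier M" using sub(1)[OF F] by blast
    then have "\<tau> a \<noteq> \<^bold>1" using a triv by (auto simp: tau_filter_def)
    moreover have "\<tau> a \<in> F \<inter> ?T"
      using F a \<open>a \<in> carrier M\<close> unfolding tau_filters_def by blast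
    ultimately show ?thesis by (metis singletonD)
  qed
  have up: "up_closure K \<in> tau_filters" "up_closure K \<noteq> {\<^bold>1}"
    if "K \<in> filters ?T" "K \<noteq> {\<^bold>1}" for K
  proof -
    show "up_closure K \<in> tau_filters" using up_closure_in_tau_filters that by blast
    have "K \<subseteq> carrier M"
      using filtersD(1)[OF that(1)] subhoopD(1)[OF subhoop_tau_image] by (meson subsetI subsetD)
    then show "up_closure K \<noteq> {\<^bold>1}"
      using up_closure_superset[of K] that(2) filtersD(2)[OF that(1)] by blast
  qed
  show ?thesis
  proof
    assume "\<exists>K. least_nontrivial K tau_filters"
    then obtain K where K: "K \<in> tau_filters" "K \<noteq> {\<^bold>1}"
      and least: "\<And>F. \<lbrakk>F \<in> tau_filters; F \<noteq> {\<^bold>1}\<rbrakk> \<Longrightarrow> K \<subseteq> F"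
      by (auto simp: least_nontrivial_def)
    have "K \<inter> ?T \<subseteq> F" if "F \<in> filters ?T" "F \<noteq> {\<^bold>1}" for F
      using Int_mono[OF least[OF up[OF that]] order_refl] up_closure_Int[OF that(1)]
      by (rule order_trans)
    then have "least_nontrivial (K \<inter> ?T) (filters ?T)"
      using tau_filters_Int_tau_image[OF K(1)] trace[OF K] by (simp add: least_nontrivial_def)
    then show "\<exists>K. least_nontrivial K (filters ?T)" by (rule exI)
  next
    assume "\<exists>K. least_nontrivial K (filters ?T)"
    then obtain K where K: "K \<in> filters ?T" "K \<noteq> {\<^bold>1}"
      and least: "\<And>F. \<lbrakk>F \<in> filters ?T; F \<noteq> {\<^bold>1}\<rbrakk> \<Longrightarrow> K \<subseteq> F"
      by (auto simp: least_nontrivial_def)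
    have "up_closure K \<subseteq> F" if F: "F \<in> tau_filters" "F \<noteq> {\<^bold>1}" for F
    proof -
      have "K \<subseteq> F"
        using least[OF tau_filters_Int_tau_image[OF F(1)] trace[OF F]] by (rule le_infE)
      moreover have "F \<in> filters (carrier M)" using F(1) by (simp add: tau_filters_def)
      ultimately show ?thesis using filtersD(4) unfolding up_closure_def by blast
    qed
    then have "least_nontrivial (up_closure K) tau_filters"
      using up[OF K] by (simp add: least_nontrivial_def)
    then show "\<exists>K. least_nontrivial K tau_filters" ..
  qed
qed

lemma least_nontrivial_tau_filter:
  assumes nontriv: "tau_filter M \<tau> \<noteq> {\<^bold>1}" and K: "least_nontrivial K tau_filters"
  shows "least_nontrivial K (filters (tau_filter M \<tau>))"
  using K tau_filter_in_tau_filters nontriv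
  by (auto simp: least_nontrivial_def filters_tau_filter_iff)

text \<open>
  Polars stand in for the filters generated by \<open>x\<close> and by \<open>y\<close>: they separate \<open>x\<close> from \<open>y\<close> without
  any comparison of powers of the two elements.
\<close>

lemma disjunction_property_if_least_nontrivial:
  assumes "least_nontrivial K tau_filters"
  shows "disjunction_property M (tau_filter M \<tau>) (\<tau> ` carrier M)"
  unfolding disjunction_property_def
proof (intro ballI impI)
  fix x y assume x: "x \<in> tau_filter M \<tau>" and y: "y \<in> \<tau> ` carrier M"
    and xy: "mv_join M x y = \<^bold>1"
  have K: "K \<in> tau_filters" "K \<noteq> {\<^bold>1}"
    and least: "\<And>F. \<lbrakk>F \<in> tau_filters; F \<noteq> {\<^bold>1}\<rbrakk> \<Longrightarrow> K \<subseteq> F"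
    using assms by (auto simp: least_nontrivial_def)
  have KM: "K \<subseteq> carrier M" "\<^bold>1 \<in> K" using K(1) by (auto simp: tau_filters_def filters_def)
  have xM: "x \<in> carrier M" and yM: "y \<in> carrier M" and \<tau>y: "\<tau> y = y"
    using x y by (auto simp: tau_filter_def tau_tau)
  show "x = \<^bold>1 \<or> y = \<^bold>1"
  proof (rule ccontr)
    assume "\<not> ?thesis"
    then have ne: "x \<noteq> \<^bold>1" "y \<noteq> \<^bold>1" by auto
    \<comment> \<open>The polar of \<open>x\<close> may fail to be closed under \<open>\<tau>\<close>, but \<open>y\<close> survives the cut because \<open>\<tau> y = y\<close>.\<close>
    let ?G = "polar {x} \<inter> {a \<in> carrier M. \<tau> a \<in> polar {x}}"
    have G: "?G \<in> tau_filters"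
      using tau_vimage_Int_in_tau_filters polar_in_filters xM by simp
    have "y \<in> ?G" using xy yM xM \<tau>y by (simp add: polar_def join_comm)
    then have "K \<subseteq> ?G" using least[OF G] ne by blast
    then have "x \<in> polar K" using xM KM by (auto simp: polar_def subset_iff join_comm)
    moreover have "polar K \<inter> tau_filter M \<tau> \<in> tau_filters"
      using filters_Int[OF polar_in_filters[OF KM(1)]] tau_filter_in_tau_filters
        filtersD(2)[OF polar_in_filters[OF KM(1)]]
      by (auto simp: tau_filters_def) (simp add: tau_filter_def)
    ultimately have "K \<subseteq> polar K" using least x ne by blast
    then show False using polar_self[OF KM(1)] K(2) KM(2) by blast
  qed
qed

text \<open>
  Every nontrivial \<open>\<tau>\<close>-filter \<open>G\<close> meets \<open>F\<^sub>\<tau>(A)\<close> outside 1. Otherwise, for \<open>h \<in> G\<close> and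
  \<open>x \<in> F\<^sub>\<tau>(A)\<close> different from 1, the join of \<open>x\<close> and \<open>\<tau> h\<close> is 1, so the disjunction property gives
  \<open>\<tau> h = 1\<close>; thus \<open>h \<in> F\<^sub>\<tau>(A)\<close>, contrary to the choice of \<open>h\<close>.
\<close>

lemma least_nontrivial_from_tau_filter:
  assumes K: "least_nontrivial K (filters (tau_filter M \<tau>))"
    and disj: "disjunction_property M (tau_filter M \<tau>) (\<tau> ` carrier M)"
  shows "least_nontrivial K tau_filters"
proof -
  have T: "tau_filter M \<tau> \<in> filters (carrier M)"
    using tau_filter_in_tau_filters by (simp add: tau_filters_def)
  note t = filtersD[OF T]
  have KF: "K \<in> tau_filters" "K \<subseteq> tau_filter M \<tau>" "K \<noteq> {\<^bold>1}"
    and least: "\<And>F. \<lbrakk>F \<in> tau_filters; F \<subseteq> tau_filter M \<tau>; F \<noteq> {\<^bold>1}\<rbrakk> \<Longrightarrow> K \<subseteq> F"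
    using K by (auto simp: least_nontrivial_def filters_tau_filter_iff)
  have "\<^bold>1 \<in> K" using KF(1) by (auto simp: tau_filters_def filters_def)
  then obtain x where x: "x \<in> tau_filter M \<tau>" "x \<noteq> \<^bold>1" using KF by blast
  have "K \<subseteq> G" if G: "G \<in> tau_filters" "G \<noteq> {\<^bold>1}" for G
  proof -
    have GM: "G \<in> filters (carrier M)" using G(1) by (simp add: tau_filters_def)
    note g = filtersD[OF GM]
    have I: "G \<inter> tau_filter M \<tau> \<in> tau_filters"
      using filters_Int[OF GM T] G(1) tau_filter_in_tau_filters by (auto simp: tau_filters_def)
    have "G \<inter> tau_filter M \<tau> \<noteq> {\<^bold>1}"
    proof
      assume triv: "G \<inter> tau_filter M \<tau> = {\<^bold>1}"
      obtain h where h: "h \<in> G" "h \<noteq> \<^bold>1" using G(2) g(2) by blast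
      then have hM: "h \<in> carrier M" and \<tau>h: "\<tau> h \<in> G"
        using g(1) G(1) by (auto simp: tau_filters_def)
      have xM: "x \<in> carrier M" using x t(1) by blast
      have "mv_join M x (\<tau> h) \<in> G \<inter> tau_filter M \<tau>"
        using t(4)[OF le_join1[of x "\<tau> h"]] g(4)[OF le_join2[of x "\<tau> h"]] x \<tau>h hM xM by simp
      then have "mv_join M x (\<tau> h) = \<^bold>1" using triv by blast
      then have "\<tau> h = \<^bold>1" using disj x hM by (auto simp: disjunction_property_def)
      then have "h \<in> G \<inter> tau_filter M \<tau>" using h hM by (simp add: tau_filter_def)
      then show False using triv h by blast
    qed
    then show ?thesis using least[OF I] by blast
  qed
  then show ?thesis using KF by (auto simp: least_nontrivial_def)
qed

end

theorem theorem3p4: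
  fixes M :: "'a mv_alg" and \<tau> :: "'a \<Rightarrow> 'a"
  assumes "smv_algebra M \<tau>"
  shows "subdirectly_irreducible_smv M \<tau> \<longleftrightarrow>
    (tau_filter M \<tau> = {mv_one M} \<longrightarrow> subdirectly_irreducible_mv (tau_image M \<tau>)) \<and>
    (trivial_hoop (tau_hoop M \<tau>) \<or> subdirectly_irreducible_hoop (tau_hoop M \<tau>)) \<and>
    disjunction_property M (carrier (tau_hoop M \<tau>)) (carrier (tau_image M \<tau>))"
proof -
  interpret smv_algebra M \<tau> by (rule assms)
  have triv: "trivial_hoop (tau_hoop M \<tau>) \<longleftrightarrow> tau_filter M \<tau> = {mv_one M}"
    using subhoopD(2)[OF subhoop_tau_filter] by (auto simp: tau_hoop_def is_singleton_def)
  have carriers: "carrier (tau_hoop M \<tau>) = tau_filter M \<tau>"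
    "carrier (tau_image M \<tau>) = \<tau> ` carrier M"
    by (simp_all add: tau_hoop_def tau_image_def)
  show ?thesis
    unfolding triv subdirectly_irreducible_smv_iff
      subdirectly_irreducible_tau_image_iff subdirectly_irreducible_tau_hoop_iff
    unfolding carriers
    using least_nontrivial_tau_image_iff least_nontrivial_tau_filter
      disjunction_property_if_least_nontrivial least_nontrivial_from_tau_filter
    by blast
qed

end
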